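(* Let $m\geq 2$ be an integer and let $2m\leq p\leq\infty$. Let $C_{m,p}^{\mathbb{R}}$ denote the optimal constant of the Hardy--Littlewood inequality for real scalars, i.e. the smallest constant $C$ such that, for every positive integer $N$ and every continuous $m$-linear form $A:\ell_{p}^{N}\times\cdots\times\ell_{p}^{N}\rightarrow\mathbb{R}$, \[ \left(\sum_{j_{1},\ldots,j_{m}=1}^{N}\left\vert A(e_{j_{1}},\ldots,e_{j_{m}})\right\vert^{\frac{2mp}{mp+p-2m}}\right)^{\frac{mp+p-2m}{2mp}}\leq C\,\Vert A\Vert . \] Then \[ C_{m,p}^{\mathbb{R}}>1 . \]
   Context: Here $\ell_{p}^{N}$ is $\mathbb{R}^{N}$ with the $\ell_p$-norm ($\Vert x\Vert_p=(\sum_{j}|x_j|^p)^{1/p}$ for $p<\infty$ and $\Vert x\Vert_\infty=\max_j|x_j|$), $e_{1},\ldots,e_{N}$ are the canonical basis vectors of $\mathbb{R}^N$, and $\Vert A\Vert=\sup\{|A(x^{(1)},\ldots,x^{(m)})|:\Vert x^{(k)}\Vert_{p}\leq 1,\ 1\leq k\leq m\}$. For $p=\infty$ the exponent $\frac{2mp}{mp+p-2m}$ is understood as its limit $\frac{2m}{m+1}$ (the Bohnenblust--Hille inequality). The Hardy--Littlewood inequality (Hardy--Littlewood for $m=2$, Praciano-Pereira for general $m$) is the known fact that for every integer $m\geq 2$ and every $p\geq 2m$ there is a finite constant $C\geq 1$, depending only on $m$ and $p$ and not on $N$ or $A$, for which the displayed inequality holds; hence the optimal constant is well defined and finite. *)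

theory Defs
  imports "Jordan_Normal_Form.Matrix" "HOL-Library.Extended_Real"
begin

text \<open>
  The vectors of \<open>\<real>\<^sup>N\<close> are the elements of \<^term>\<open>carrier_vec N :: real vec set\<close>, with
  coordinates and basis vectors indexed by \<open>0, \<dots>, N - 1\<close>.
\<close>

text \<open>Meant for \<open>1 \<le> p \<le> \<infinity>\<close> and, if \<open>p = \<infinity>\<close>, nonzero dimension.\<close>

definition pnorm :: "ereal \<Rightarrow> real vec \<Rightarrow> real" where
  "pnorm p x =
    (if p = \<infinity> then Max ((\<lambda>i. \<bar>x $ i\<bar>) ` {..<dim_vec x})
     else (\<Sum>i<dim_vec x. \<bar>x $ i\<bar> powr real_of_ereal p) powr (1 / real_of_ereal p))"

definition tuples :: "nat \<Rightarrow> nat \<Rightarrow> real vec list set" where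
  "tuples m N = {xs. length xs = m \<and> set xs \<subseteq> carrier_vec N}"

definition multilinear_form :: "nat \<Rightarrow> nat \<Rightarrow> (real vec list \<Rightarrow> real) \<Rightarrow> bool" where
  "multilinear_form m N A \<longleftrightarrow>
    (\<forall>xs \<in> tuples m N. \<forall>k<m.
      (\<forall>x \<in> carrier_vec N. \<forall>y \<in> carrier_vec N.
        A (xs[k := x + y]) = A (xs[k := x]) + A (xs[k := y])) \<and>
      (\<forall>c. \<forall>x \<in> carrier_vec N. A (xs[k := c \<cdot>\<^sub>v x]) = c * A (xs[k := x])))"

definition continuous_form :: "ereal \<Rightarrow> nat \<Rightarrow> nat \<Rightarrow> (real vec list \<Rightarrow> real) \<Rightarrow> bool" where
  "continuous_form p m N A \<longleftrightarrow>
    (\<forall>xs \<in> tuples m N. \<forall>e>0. \<exists>d>0. \<forall>ys \<in> tuples m N.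
      (\<forall>k<m. pnorm p (ys ! k - xs ! k) < d) \<longrightarrow> \<bar>A ys - A xs\<bar> < e)"

definition form_norm :: "ereal \<Rightarrow> nat \<Rightarrow> nat \<Rightarrow> (real vec list \<Rightarrow> real) \<Rightarrow> real" where
  "form_norm p m N A =
    Sup {\<bar>A xs\<bar> | xs. xs \<in> tuples m N \<and> (\<forall>k<m. pnorm p (xs ! k) \<le> 1)}"

text \<open>At \<open>p = \<infinity>\<close> this is the limit, the Bohnenblust--Hille exponent.\<close>

definition hl_exponent :: "nat \<Rightarrow> ereal \<Rightarrow> real" where
  "hl_exponent m p =
    (if p = \<infinity> then 2 * real m / (real m + 1)
     else 2 * real m * real_of_ereal p
          / (real m * real_of_ereal p + real_of_ereal p - 2 * real m))"

definition hl_inequality :: "nat \<Rightarrow> ereal \<Rightarrow> real \<Rightarrow> bool" where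
  "hl_inequality m p C \<longleftrightarrow>
    (\<forall>N\<ge>1. \<forall>A. multilinear_form m N A \<and> continuous_form p m N A \<longrightarrow>
      (\<Sum>js | length js = m \<and> set js \<subseteq> {..<N}.
          \<bar>A (map (unit_vec N) js)\<bar> powr hl_exponent m p) powr (1 / hl_exponent m p)
      \<le> C * form_norm p m N A)"

text \<open>
  The admissible constants form a closed set that is bounded below, so their infimum is the
  smallest one.  The infimum is taken in \<^typ>\<open>ereal\<close> because on \<^typ>\<open>real\<close> it would be
  unspecified without the Hardy--Littlewood theorem, which says that some constant is admissible.
\<close>

definition hl_const :: "nat \<Rightarrow> ereal \<Rightarrow> ereal" where
  "hl_const m p = Inf {ereal C | C. hl_inequality m p C}"

end

theory Submission
  imports Defs
begin

text \<open>
  A single form whose coefficient norm exceeds its operator norm forces the optimal constant above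
  \<open>1\<close>, and a form on \<open>\<real>\<^sup>2\<close> is enough.  Start from Littlewood's bilinear form
  \<open>a (y + z) + b (y - z)\<close>, whose matrix is the \<open>2 \<times> 2\<close> Hadamard matrix, and replace \<open>a\<close> and \<open>b\<close> by
  the products of the first and of the second coordinates of the first \<open>m - 1\<close> vectors; \<open>(y, z)\<close>
  is the last vector.  However large \<open>m\<close> is, this form has just four nonzero coefficients, all
  \<open>\<plusminus>1\<close>, so with the Hardy--Littlewood exponent \<open>q\<close> its coefficient norm is \<open>4 powr (1 / q)\<close>.  The
  assumption \<open>p \<ge> 2 m\<close> says exactly that \<open>q \<le> 2\<close>, so the coefficient norm is at least \<open>2\<close>, and more
  than \<open>2\<close> unless \<open>p = 2 m\<close>.

  On the other side, the form is bounded by \<open>2\<close> on the unit ball because all coordinates there have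
  modulus at most \<open>1\<close>.  This settles every \<open>p > 2 m\<close>, including \<open>p = \<infinity>\<close>.  In the borderline case
  \<open>p = 2 m\<close> the bound has to be strict.  For finite \<open>p\<close> the smaller coordinate of a vector in the
  unit ball of \<open>\<real>\<^sup>2\<close> is at most \<open>c = 2 powr (- 1 / p) < 1\<close> (lemma \<open>min_coord_le\<close>), whereas the value
  \<open>2\<close> would require \<open>\<bar>y\<bar> = \<bar>z\<bar> = 1\<close> or \<open>\<bar>a\<bar> = \<bar>b\<bar> = 1\<close>.  Lemma \<open>littlewood_le\<close> turns this into the bound \<open>2 - (1 - c)\<^sup>2\<close>, and
  with \<open>c = 1\<close> it also covers \<open>p = \<infinity>\<close>.
\<close>

section \<open>Bounding the optimal constant from below\<close>

text \<open>
  The ratio of the coefficient norm to any upper bound \<open>B\<close> for the norm of the form is a lower bound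
  for all admissible constants, hence for their infimum.  The unit ball has to
  contain some point \<open>zs\<close>, since the supremum of the empty set of reals is unspecified; such a point
  also shows that the norm is nonnegative, so that admissible constants are positive.
\<close>

lemma hl_const_gt_1_if_form:
  assumes ml: "multilinear_form m N A" and cont: "continuous_form p m N A" and N: "1 \<le> N"
    and bound: "\<And>xs. xs \<in> tuples m N \<Longrightarrow> (\<forall>k<m. pnorm p (xs ! k) \<le> 1) \<Longrightarrow> \<bar>A xs\<bar> \<le> B"
    and less: "B < (\<Sum>js | length js = m \<and> set js \<subseteq> {..<N}.
          \<bar>A (map (unit_vec N) js)\<bar> powr hl_exponent m p) powr (1 / hl_exponent m p)"
      (is "B < ?L")
    and ball: "zs \<in> tuples m N" "\<forall>k<m. pnorm p (zs ! k) \<le> 1"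
    and pos: "0 < B"
  shows "hl_const m p > 1"
proof -
  have norm_le: "form_norm p m N A \<le> B"
    unfolding form_norm_def by (rule cSup_least) (use ball bound in auto)
  have "\<bar>A zs\<bar> \<le> form_norm p m N A"
    unfolding form_norm_def
    by (rule cSup_upper) (use ball bound in \<open>auto simp: bdd_above_def\<close>)
  then have norm_ge: "0 \<le> form_norm p m N A" by linarith
  have "ereal (?L / B) \<le> ereal C" if "hl_inequality m p C" for C
  proof -
    have le: "?L \<le> C * form_norm p m N A"
      using that ml cont N unfolding hl_inequality_def by blast
    have "0 < C"
    proof (rule ccontr)
      assume "\<not> 0 < C"
      then have "C * form_norm p m N A \<le> 0"
        using norm_ge by (simp add: mult_nonpos_nonneg)
      then show False using le less pos by linarith
    qed
    then have "?L \<le> C * B"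
      using le norm_le by (meson mult_left_mono less_imp_le order_trans)
    then show ?thesis using pos by (simp add: divide_le_eq)
  qed
  then have "ereal (?L / B) \<le> hl_const m p"
    unfolding hl_const_def by (auto intro!: Inf_greatest)
  moreover have "1 < ereal (?L / B)"
    using less pos by (simp add: one_ereal_def)
  ultimately show ?thesis by (rule less_le_trans[rotated])
qed

section \<open>Coordinates in the unit ball\<close>

lemma nth_tuples: "xs \<in> tuples m N \<Longrightarrow> k < m \<Longrightarrow> xs ! k \<in> carrier_vec N"
  unfolding tuples_def by (metis (mono_tags, lifting) mem_Collect_eq nth_mem subsetD)

lemma abs_coord_le_pnorm:
  assumes "1 \<le> p" and "i < dim_vec x"
  shows "\<bar>x $ i\<bar> \<le> pnorm p x"
proof (cases "p = \<infinity>")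
  case True
  then show ?thesis using assms by (auto simp: pnorm_def intro!: Max_ge)
next
  case False
  then obtain r where r: "p = ereal r" "1 \<le> r"
    using assms(1) by (cases p) (auto simp: one_ereal_def)
  have "\<bar>x $ i\<bar> = (\<bar>x $ i\<bar> powr r) powr (1 / r)"
    using r by (simp add: powr_powr)
  also have "\<dots> \<le> (\<Sum>i<dim_vec x. \<bar>x $ i\<bar> powr r) powr (1 / r)"
    using r assms(2) by (intro powr_mono2 member_le_sum) auto
  finally show ?thesis using r by (simp add: pnorm_def)
qed

lemma min_coord_le:
  assumes "1 \<le> r" and x: "x \<in> carrier_vec 2" and "pnorm (ereal r) x \<le> 1"
  shows "min \<bar>x $ 0\<bar> \<bar>x $ 1\<bar> \<le> 2 powr (- 1 / r)"
proof -
  let ?m = "min \<bar>x $ 0\<bar> \<bar>x $ 1\<bar>"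
  have "?m powr r + ?m powr r \<le> \<bar>x $ 0\<bar> powr r + \<bar>x $ 1\<bar> powr r"
    using assms(1) by (intro add_mono powr_mono2) auto
  also have "\<dots> \<le> 1"
  proof (rule ccontr)
    assume "\<not> \<bar>x $ 0\<bar> powr r + \<bar>x $ 1\<bar> powr r \<le> 1"
    then have "1 < (\<bar>x $ 0\<bar> powr r + \<bar>x $ 1\<bar> powr r) powr (1 / r)"
      using assms(1) by (intro gr_one_powr) auto
    then show False
      using assms by (simp add: pnorm_def carrier_vecD numeral_2_eq_2)
  qed
  finally have "(?m powr r) powr (1 / r) \<le> (1 / 2) powr (1 / r)"
    using assms(1) by (intro powr_mono2) auto
  then show ?thesis
    using assms(1) by (simp add: powr_powr powr_divide powr_minus_divide)
qed

section \<open>Monomial forms\<close>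

text \<open>
  The word \<open>w\<close> selects one coordinate from each argument.  These forms are the dual basis to the
  tuples of unit vectors (lemma \<open>word_form_unit_vec\<close>), so the coefficients of a combination of
  them can be read off.
\<close>

definition word_form :: "nat list \<Rightarrow> real vec list \<Rightarrow> real" where
  "word_form w xs = (\<Prod>k<length w. xs ! k $ (w ! k))"

lemma word_form_update:
  assumes "length xs = length w" and "k < length w"
  shows "word_form w (xs[k := x]) = x $ (w ! k) * (\<Prod>i\<in>{..<length w} - {k}. xs ! i $ (w ! i))"
proof -
  have "word_form w (xs[k := x])
      = (xs[k := x]) ! k $ (w ! k) * (\<Prod>i\<in>{..<length w} - {k}. (xs[k := x]) ! i $ (w ! i))"
    unfolding word_form_def by (rule prod.remove) (use assms in auto)
  then show ?thesis using assms by (auto intro!: arg_cong2[of _ _ _ _ "(*)"] prod.cong)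
qed

lemma multilinear_word_form:
  assumes "length w = m" and "set w \<subseteq> {..<N}"
  shows "multilinear_form m N (word_form w)"
proof -
  have "w ! k < N" if "k < m" for k
    using assms that nth_mem by blast
  then show ?thesis
    unfolding multilinear_form_def tuples_def using assms(1)
    by (auto simp: word_form_update carrier_vecD algebra_simps)
qed

text \<open>
  The continuity required of forms is convergence along the filter generated by the \<open>pnorm\<close>-balls
  around a tuple.  Coordinates converge along it because they are dominated by the norm, and then
  so do their products.
\<close>

lemma continuous_word_form:
  assumes p: "1 \<le> p" and "length w = m" and "set w \<subseteq> {..<N}"
  shows "continuous_form p m N (word_form w)"
  unfolding continuous_form_def
proof (intro ballI allI impI)
  fix xs and e :: real
  assume xs: "xs \<in> tuples m N" and e: "0 < e"
  let ?U = "\<lambda>d. {ys \<in> tuples m N. \<forall>k<m. pnorm p (ys ! k - xs ! k) < d}"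
  define F where "F = (INF d\<in>{0<..}. principal (?U d))"
  have ev: "eventually P F \<longleftrightarrow> (\<exists>d>0. \<forall>ys\<in>?U d. P ys)" for P
    unfolding F_def
  proof (subst eventually_INF_base)
    show "{0<..} \<noteq> ({} :: real set)" by (metis greaterThan_non_empty)
    show "\<exists>x\<in>{0<..}. principal (?U x) \<le> inf (principal (?U a)) (principal (?U b))"
      if "a \<in> {0<..}" "b \<in> {0<..}" for a b
      using that by (intro bexI[of _ "min a b"]) auto
  qed (auto simp: eventually_principal)
  have coord: "((\<lambda>ys. ys ! k $ (w ! k)) \<longlongrightarrow> xs ! k $ (w ! k)) F" if k: "k < m" for k
    unfolding tendsto_iff ev
  proof (intro allI impI)
    fix d :: real assume "0 < d"
    have wk: "w ! k < N" using assms k nth_mem by blast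
    have "dist (ys ! k $ (w ! k)) (xs ! k $ (w ! k)) < d" if "ys \<in> ?U d" for ys
    proof -
      have "ys ! k \<in> carrier_vec N" "xs ! k \<in> carrier_vec N"
        using that xs k by (auto intro: nth_tuples)
      then have "\<bar>ys ! k $ (w ! k) - xs ! k $ (w ! k)\<bar> \<le> pnorm p (ys ! k - xs ! k)"
        using abs_coord_le_pnorm[OF p, of "w ! k" "ys ! k - xs ! k"] wk by auto
      then show ?thesis using that k by (fastforce simp: dist_real_def)
    qed
    then show "\<exists>d'>0. \<forall>ys\<in>?U d'. dist (ys ! k $ (w ! k)) (xs ! k $ (w ! k)) < d"
      using \<open>0 < d\<close> by blast
  qed
  have "(word_form w \<longlongrightarrow> word_form w xs) F"
    unfolding word_form_def using coord assms(2) by (auto intro!: tendsto_prod)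
  then have "\<exists>d>0. \<forall>ys\<in>?U d. dist (word_form w ys) (word_form w xs) < e"
    using e unfolding tendsto_iff ev by blast
  then show "\<exists>d>0. \<forall>ys\<in>tuples m N. (\<forall>k<m. pnorm p (ys ! k - xs ! k) < d) \<longrightarrow>
      \<bar>word_form w ys - word_form w xs\<bar> < e"
    by (auto simp: dist_real_def)
qed

lemma word_form_unit_vec:
  assumes "length js = length w" and "set js \<subseteq> {..<N}" and "set w \<subseteq> {..<N}"
  shows "word_form w (map (unit_vec N) js) = (if js = w then 1 else 0)"
proof -
  have "word_form w (map (unit_vec N) js) = (\<Prod>k<length w. if js ! k = w ! k then 1 else 0)"
    unfolding word_form_def
  proof (rule prod.cong)
    fix k assume "k \<in> {..<length w}"
    then have "js ! k < N" "w ! k < N" "k < length js"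
      using assms nth_mem by (auto simp: subset_iff)
    then show "map (unit_vec N) js ! k $ (w ! k) = (if js ! k = w ! k then 1 else 0)"
      by auto
  qed simp
  also have "\<dots> = (if js = w then 1 else 0)"
    using assms(1) by (auto simp: list_eq_iff_nth_eq)
  finally show ?thesis .
qed

lemma multilinear_form_add:
  assumes A: "multilinear_form m N A" and B: "multilinear_form m N B"
  shows "multilinear_form m N (\<lambda>xs. A xs + B xs)"
  unfolding multilinear_form_def
proof (intro ballI allI impI conjI)
  fix xs k and x y :: "real vec"
  assume *: "xs \<in> tuples m N" "k < m" "x \<in> carrier_vec N" "y \<in> carrier_vec N"
  have "A (xs[k := x + y]) = A (xs[k := x]) + A (xs[k := y])"
    using A * unfolding multilinear_form_def by blast
  moreover have "B (xs[k := x + y]) = B (xs[k := x]) + B (xs[k := y])"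
    using B * unfolding multilinear_form_def by blast
  ultimately show "A (xs[k := x + y]) + B (xs[k := x + y])
      = A (xs[k := x]) + B (xs[k := x]) + (A (xs[k := y]) + B (xs[k := y]))"
    by simp
next
  fix xs k c and x :: "real vec"
  assume *: "xs \<in> tuples m N" "k < m" "x \<in> carrier_vec N"
  have "A (xs[k := c \<cdot>\<^sub>v x]) = c * A (xs[k := x])"
    using A * unfolding multilinear_form_def by blast
  moreover have "B (xs[k := c \<cdot>\<^sub>v x]) = c * B (xs[k := x])"
    using B * unfolding multilinear_form_def by blast
  ultimately show "A (xs[k := c \<cdot>\<^sub>v x]) + B (xs[k := c \<cdot>\<^sub>v x])
      = c * (A (xs[k := x]) + B (xs[k := x]))"
    by (simp add: distrib_left)
qed

lemma multilinear_form_diff: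
  assumes A: "multilinear_form m N A" and B: "multilinear_form m N B"
  shows "multilinear_form m N (\<lambda>xs. A xs - B xs)"
  unfolding multilinear_form_def
proof (intro ballI allI impI conjI)
  fix xs k and x y :: "real vec"
  assume *: "xs \<in> tuples m N" "k < m" "x \<in> carrier_vec N" "y \<in> carrier_vec N"
  have "A (xs[k := x + y]) = A (xs[k := x]) + A (xs[k := y])"
    using A * unfolding multilinear_form_def by blast
  moreover have "B (xs[k := x + y]) = B (xs[k := x]) + B (xs[k := y])"
    using B * unfolding multilinear_form_def by blast
  ultimately show "A (xs[k := x + y]) - B (xs[k := x + y])
      = A (xs[k := x]) - B (xs[k := x]) + (A (xs[k := y]) - B (xs[k := y]))"
    by simp
next
  fix xs k c and x :: "real vec"
  assume *: "xs \<in> tuples m N" "k < m" "x \<in> carrier_vec N"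
  have "A (xs[k := c \<cdot>\<^sub>v x]) = c * A (xs[k := x])"
    using A * unfolding multilinear_form_def by blast
  moreover have "B (xs[k := c \<cdot>\<^sub>v x]) = c * B (xs[k := x])"
    using B * unfolding multilinear_form_def by blast
  ultimately show "A (xs[k := c \<cdot>\<^sub>v x]) - B (xs[k := c \<cdot>\<^sub>v x])
      = c * (A (xs[k := x]) - B (xs[k := x]))"
    by (simp add: right_diff_distrib)
qed

lemma continuous_form_combine:
  assumes A: "continuous_form p m N A" and B: "continuous_form p m N B"
    and C: "\<And>xs ys. \<bar>C ys - C xs\<bar> \<le> \<bar>A ys - A xs\<bar> + \<bar>B ys - B xs\<bar>"
  shows "continuous_form p m N C"
  unfolding continuous_form_def
proof (intro ballI allI impI)
  fix xs and e :: real
  assume xs: "xs \<in> tuples m N" and e: "0 < e"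
  have "0 < e / 2" using e by simp
  obtain d1 where d1: "0 < d1" "\<forall>ys \<in> tuples m N. (\<forall>k<m. pnorm p (ys ! k - xs ! k) < d1) \<longrightarrow>
      \<bar>A ys - A xs\<bar> < e / 2"
    using A[unfolded continuous_form_def, rule_format, OF xs \<open>0 < e / 2\<close>] by auto
  obtain d2 where d2: "0 < d2" "\<forall>ys \<in> tuples m N. (\<forall>k<m. pnorm p (ys ! k - xs ! k) < d2) \<longrightarrow>
      \<bar>B ys - B xs\<bar> < e / 2"
    using B[unfolded continuous_form_def, rule_format, OF xs \<open>0 < e / 2\<close>] by auto
  have "\<bar>C ys - C xs\<bar> < e"
    if "ys \<in> tuples m N" "\<forall>k<m. pnorm p (ys ! k - xs ! k) < min d1 d2" for ys
  proof -
    have "\<bar>A ys - A xs\<bar> < e / 2" "\<bar>B ys - B xs\<bar> < e / 2"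
      using d1(2) d2(2) that by simp_all
    then show ?thesis using C[of ys xs] by linarith
  qed
  then show "\<exists>d>0. \<forall>ys\<in>tuples m N. (\<forall>k<m. pnorm p (ys ! k - xs ! k) < d) \<longrightarrow>
      \<bar>C ys - C xs\<bar> < e"
    using d1(1) d2(1) by (intro exI[of _ "min d1 d2"]) auto
qed

section \<open>The collapsed Littlewood form\<close>

text \<open>
  The form takes \<open>n + 1\<close> arguments; the first \<open>n\<close> of them enter only through the two products that
  replace the first argument of Littlewood's form.
\<close>

definition collapsed_littlewood :: "nat \<Rightarrow> real vec list \<Rightarrow> real" where
  "collapsed_littlewood n xs =
    word_form (replicate n 0 @ [0]) xs + word_form (replicate n 0 @ [1]) xs
    + (word_form (replicate n 1 @ [0]) xs - word_form (replicate n 1 @ [1]) xs)"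

lemma word_form_replicate_snoc:
  "word_form (replicate n i @ [j]) xs = (\<Prod>k<n. xs ! k $ i) * xs ! n $ j"
  by (simp add: word_form_def nth_append)

lemma multilinear_collapsed_littlewood:
  "multilinear_form (Suc n) 2 (collapsed_littlewood n)"
  unfolding collapsed_littlewood_def[abs_def]
  by (intro multilinear_form_add multilinear_form_diff multilinear_word_form) auto

lemma continuous_collapsed_littlewood:
  assumes "1 \<le> p"
  shows "continuous_form p (Suc n) 2 (collapsed_littlewood n)"
proof -
  have w: "continuous_form p (Suc n) 2 (word_form (replicate n i @ [j]))" if "i < 2" "j < 2" for i j
    using assms that by (intro continuous_word_form) auto
  have "continuous_form p (Suc n) 2
      (\<lambda>xs. word_form (replicate n 0 @ [0]) xs + word_form (replicate n 0 @ [1]) xs)"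
    by (rule continuous_form_combine[OF w[of 0 0] w[of 0 1]]) auto
  moreover have "continuous_form p (Suc n) 2
      (\<lambda>xs. word_form (replicate n 1 @ [0]) xs - word_form (replicate n 1 @ [1]) xs)"
    by (rule continuous_form_combine[OF w[of 1 0] w[of 1 1]]) auto
  ultimately show ?thesis
    by (rule continuous_form_combine) (auto simp: collapsed_littlewood_def)
qed

lemma sum_collapsed_littlewood:
  assumes "0 < n"
  shows "(\<Sum>js | length js = Suc n \<and> set js \<subseteq> {..<2}.
      \<bar>collapsed_littlewood n (map (unit_vec 2) js)\<bar> powr q) = 4"
proof -
  let ?w = "\<lambda>i j. replicate n i @ [j :: nat]"
  let ?W = "{?w 0 0, ?w 0 1, ?w 1 0, ?w 1 1}"
  have ne: "replicate n (0::nat) \<noteq> replicate n 1"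
    using assms by (cases n) auto
  have "(\<Sum>js | length js = Suc n \<and> set js \<subseteq> {..<2}.
      \<bar>collapsed_littlewood n (map (unit_vec 2) js)\<bar> powr q)
    = (\<Sum>js | length js = Suc n \<and> set js \<subseteq> {..<2}. if js \<in> ?W then 1 else 0)"
  proof (rule sum.cong)
    fix js :: "nat list" assume js: "js \<in> {js. length js = Suc n \<and> set js \<subseteq> {..<2}}"
    have "word_form (?w i j) (map (unit_vec 2) js) = (if js = ?w i j then 1 else 0)"
      if "i < 2" "j < 2" for i j
      using js that by (intro word_form_unit_vec) auto
    from this[of 0 0] this[of 0 1] this[of 1 0] this[of 1 1]
    show "\<bar>collapsed_littlewood n (map (unit_vec 2) js)\<bar> powr q = (if js \<in> ?W then 1 else 0)"
      using ne by (auto simp: collapsed_littlewood_def)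
  qed simp
  also have "\<dots> = (\<Sum>js\<in>?W. 1)"
  proof (rule sum.mono_neutral_cong_right)
    show "finite {js. length js = Suc n \<and> set js \<subseteq> {..<2::nat}}"
      using finite_lists_length_eq[of "{..<2::nat}" "Suc n"] by (simp add: conj_commute)
  qed auto
  also have "\<dots> = 4"
    using ne by simp
  finally show ?thesis .
qed

text \<open>
  Up to order, \<open>\<bar>y + z\<bar>\<close> and \<open>\<bar>y - z\<bar>\<close> are \<open>M + t\<close> and \<open>M - t\<close>, where \<open>M\<close> and \<open>t\<close> are the larger and the
  smaller of \<open>\<bar>y\<bar>\<close> and \<open>\<bar>z\<bar>\<close>.  The left-hand side is therefore largest when the larger of \<open>\<bar>a\<bar>\<close>,
  \<open>\<bar>b\<bar>\<close> multiplies \<open>M + t\<close>.  The resulting expression increases in both larger coordinates, bounded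
  by \<open>1\<close>, and, once these are replaced by \<open>1\<close>, in both smaller ones, bounded by \<open>c\<close>.
\<close>

lemma littlewood_le:
  fixes a b y z c :: real
  assumes "\<bar>a\<bar> \<le> 1" "\<bar>b\<bar> \<le> 1" "min \<bar>a\<bar> \<bar>b\<bar> \<le> c"
    and "\<bar>y\<bar> \<le> 1" "\<bar>z\<bar> \<le> 1" "min \<bar>y\<bar> \<bar>z\<bar> \<le> c" and "c \<le> 1"
  shows "\<bar>a\<bar> * \<bar>y + z\<bar> + \<bar>b\<bar> * \<bar>y - z\<bar> \<le> 2 - (1 - c)\<^sup>2"
proof -
  define s where "s = min \<bar>a\<bar> \<bar>b\<bar>"
  define M where "M = max \<bar>y\<bar> \<bar>z\<bar>"
  define t where "t = min \<bar>y\<bar> \<bar>z\<bar>"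
  have b: "0 \<le> s" "s \<le> c" "0 \<le> t" "t \<le> c" "t \<le> M" "M \<le> 1"
    using assms by (simp_all add: s_def M_def t_def min_le_iff_disj le_max_iff_disj)
  have *: "\<alpha> * (M + t) + \<beta> * (M - t) \<le> 1 * (M + t) + min \<alpha> \<beta> * (M - t)"
    if "\<alpha> \<le> 1" "\<beta> \<le> 1" for \<alpha> \<beta>
  proof -
    have "\<alpha> * (M + t) + \<beta> * (M - t) \<le> max \<alpha> \<beta> * (M + t) + min \<alpha> \<beta> * (M - t)"
    proof (cases "\<beta> \<le> \<alpha>")
      case False
      then have "0 \<le> (\<beta> - \<alpha>) * t" using b by simp
      then show ?thesis using False by (simp add: algebra_simps)
    qed (simp add: max_def min_def)
    also have "\<dots> \<le> 1 * (M + t) + min \<alpha> \<beta> * (M - t)"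
      using that b by (intro add_mono mult_right_mono) auto
    finally show ?thesis .
  qed
  consider (same) "\<bar>y + z\<bar> = M + t" "\<bar>y - z\<bar> = M - t" | (opposite) "\<bar>y + z\<bar> = M - t" "\<bar>y - z\<bar> = M + t"
    by (cases "0 \<le> y"; cases "0 \<le> z"; cases "\<bar>y\<bar> \<le> \<bar>z\<bar>") (auto simp: M_def t_def)
  then have "\<bar>a\<bar> * \<bar>y + z\<bar> + \<bar>b\<bar> * \<bar>y - z\<bar> \<le> 1 * (M + t) + s * (M - t)"
  proof cases
    case same
    then show ?thesis using *[of "\<bar>a\<bar>" "\<bar>b\<bar>"] assms(1,2) by (simp add: s_def)
  next
    case opposite
    then show ?thesis using *[of "\<bar>b\<bar>" "\<bar>a\<bar>"] assms(1,2) by (simp add: s_def min.commute)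
  qed
  also have "\<dots> = (1 + s) * M + (1 - s) * t" by (simp add: algebra_simps)
  also have "\<dots> \<le> (1 + s) * 1 + (1 - s) * c"
    using b assms(7) by (intro add_mono mult_left_mono) auto
  also have "\<dots> = 1 + c + (1 - c) * s" by (simp add: algebra_simps)
  also have "\<dots> \<le> 1 + c + (1 - c) * c"
    using b assms(7) by (intro add_mono mult_left_mono) auto
  also have "\<dots> = 2 - (1 - c)\<^sup>2" by (simp add: power2_eq_square algebra_simps)
  finally show ?thesis .
qed

text \<open>
  All factors have modulus at most \<open>1\<close>, so each product is dominated by its first factor.  This
  leaves Littlewood's bilinear form at the first and the last vector.
\<close>

lemma abs_collapsed_littlewood_le:
  assumes "0 < n"
    and le1: "\<And>k i. k \<le> n \<Longrightarrow> i < 2 \<Longrightarrow> \<bar>xs ! k $ i\<bar> \<le> 1"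
    and min: "\<And>k. k \<le> n \<Longrightarrow> min \<bar>xs ! k $ 0\<bar> \<bar>xs ! k $ 1\<bar> \<le> c" and "c \<le> 1"
  shows "\<bar>collapsed_littlewood n xs\<bar> \<le> 2 - (1 - c)\<^sup>2"
proof -
  let ?u = "\<lambda>i. \<Prod>k<n. xs ! k $ i"
  let ?y = "xs ! n $ 0" and ?z = "xs ! n $ 1"
  have u: "\<bar>?u i\<bar> \<le> \<bar>xs ! 0 $ i\<bar>" if "i < 2" for i
  proof -
    have "\<bar>?u i\<bar> = \<bar>xs ! 0 $ i\<bar> * (\<Prod>k\<in>{..<n} - {0}. \<bar>xs ! k $ i\<bar>)"
      using assms(1) by (simp add: abs_prod abs_mult prod.remove)
    also have "\<dots> \<le> \<bar>xs ! 0 $ i\<bar> * 1"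
      using le1 that by (intro mult_left_mono prod_le_1) auto
    finally show ?thesis by simp
  qed
  have "collapsed_littlewood n xs = ?u 0 * (?y + ?z) + ?u 1 * (?y - ?z)"
    by (simp add: collapsed_littlewood_def word_form_replicate_snoc algebra_simps)
  then have "\<bar>collapsed_littlewood n xs\<bar> \<le> \<bar>?u 0\<bar> * \<bar>?y + ?z\<bar> + \<bar>?u 1\<bar> * \<bar>?y - ?z\<bar>"
    using abs_triangle_ineq by (metis abs_mult)
  also have "\<dots> \<le> \<bar>xs ! 0 $ 0\<bar> * \<bar>?y + ?z\<bar> + \<bar>xs ! 0 $ 1\<bar> * \<bar>?y - ?z\<bar>"
    using u by (intro add_mono mult_right_mono) auto
  also have "\<dots> \<le> 2 - (1 - c)\<^sup>2"
    using le1 min assms(1,4) by (intro littlewood_le) auto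
  finally show ?thesis .
qed

lemma pnorm_zero_le_1: "pnorm p (0\<^sub>v 2) \<le> 1"
proof (cases "p = \<infinity>")
  case True
  have "(\<lambda>i. \<bar>0\<^sub>v 2 $ i :: real\<bar>) ` {..<2} = {0}" by (auto simp: image_iff intro!: exI[of _ "0::nat"])
  then show ?thesis using True by (simp add: pnorm_def)
next
  case False
  then show ?thesis by (simp add: pnorm_def)
qed

theorem theorem1p2:
  fixes m :: nat and p :: ereal
  assumes "2 \<le> m" and "ereal (2 * real m) \<le> p"
  shows "hl_const m p > 1"
proof -
  obtain n where n: "m = Suc n" "0 < n"
    using assms(1) by (cases m) auto
  define q where "q = hl_exponent m p"
  \<comment> \<open>The largest value that the smaller coordinate of a vector in the unit ball can take.\<close>
  define c where "c = (if p = \<infinity> then 1 else 2 powr (- 1 / real_of_ereal p))"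
  have p1: "1 \<le> p"
    using assms by (intro order_trans[OF _ assms(2)]) (simp add: one_ereal_def)
  have "0 < q \<and> q \<le> 2 \<and> c \<le> 1 \<and> 0 < c \<and> (q < 2 \<or> c < 1)"
  proof (cases "p = \<infinity>")
    case True
    then show ?thesis
      using assms(1) by (simp add: q_def c_def hl_exponent_def field_simps)
  next
    case False
    then obtain r where r: "p = ereal r" "2 * real m \<le> r"
      using assms(2) by (cases p) auto
    have "0 < r" using r assms(1) by linarith
    then have "0 < real m * r" using assms(1) by simp
    then have d: "0 < real m * r + r - 2 * real m" using r by linarith
    have "c < 1" using \<open>0 < r\<close> r by (simp add: c_def powr_less_one)
    moreover have q_eq: "q = 2 * (real m * r) / (real m * r + r - 2 * real m)"
      using r by (simp add: q_def hl_exponent_def)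
    moreover have "q \<le> 2"
      unfolding q_eq using d r by (simp add: divide_le_eq)
    moreover have "0 < q"
      unfolding q_eq using d \<open>0 < real m * r\<close> by (intro divide_pos_pos) simp_all
    ultimately show ?thesis using r by (simp add: c_def)
  qed
  then have q: "0 < q" "q \<le> 2" and c: "0 < c" "c \<le> 1" and qc: "q < 2 \<or> c < 1" by auto
  \<comment> \<open>If \<open>q < 2\<close>, the coefficient norm alone exceeds \<open>2\<close>; if \<open>q = 2\<close>, it equals \<open>2\<close> and \<open>c < 1\<close> decides.\<close>
  have four: "4 powr (1 / 2) = (2::real)"
    by (simp add: powr_half_sqrt)
  have less: "2 - (1 - c)\<^sup>2 < 4 powr (1 / q)"
  proof (cases "q < 2")
    case True
    then have "2 < 4 powr (1 / q)"
      using q powr_less_mono[of "1 / 2" "1 / q" 4] four by (simp add: field_simps)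
    then show ?thesis using zero_le_power2[of "1 - c"] by linarith
  next
    case False
    then have "q = 2" using q by simp
    then show ?thesis using False qc four by simp
  qed
  have pos: "0 < 2 - (1 - c)\<^sup>2"
    using c power_le_one[of "1 - c" 2] by simp
  have bound: "\<bar>collapsed_littlewood n xs\<bar> \<le> 2 - (1 - c)\<^sup>2"
    if xs: "xs \<in> tuples m 2" "\<forall>k<m. pnorm p (xs ! k) \<le> 1" for xs
  proof (rule abs_collapsed_littlewood_le)
    fix k assume "k \<le> n"
    then have k: "xs ! k \<in> carrier_vec 2" "pnorm p (xs ! k) \<le> 1"
      using xs n by (auto intro: nth_tuples)
    show le1: "\<bar>xs ! k $ i\<bar> \<le> 1" if "i < 2" for i
      using abs_coord_le_pnorm[OF p1, of i "xs ! k"] k that by (simp add: carrier_vecD)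
    show "min \<bar>xs ! k $ 0\<bar> \<bar>xs ! k $ 1\<bar> \<le> c"
    proof (cases "p = \<infinity>")
      case True
      then show ?thesis using le1[of 0] by (simp add: c_def)
    next
      case False
      then obtain r where "p = ereal r" "1 \<le> r"
        using p1 by (cases p) (auto simp: one_ereal_def)
      then show ?thesis using min_coord_le k by (simp add: c_def)
    qed
  qed (use n c in auto)
  show ?thesis
  proof (rule hl_const_gt_1_if_form[OF _ _ _ bound _ _ _ pos])
    show "multilinear_form m 2 (collapsed_littlewood n)"
      and "continuous_form p m 2 (collapsed_littlewood n)"
      using multilinear_collapsed_littlewood continuous_collapsed_littlewood[OF p1] n by simp_all
    show "2 - (1 - c)\<^sup>2 < (\<Sum>js | length js = m \<and> set js \<subseteq> {..<2}.
        \<bar>collapsed_littlewood n (map (unit_vec 2) js)\<bar> powr hl_exponent m p)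
          powr (1 / hl_exponent m p)"
      using less sum_collapsed_littlewood[OF n(2)] n(1) by (simp add: q_def)
    show "replicate m (0\<^sub>v 2) \<in> tuples m 2"
      by (auto simp: tuples_def)
    show "\<forall>k<m. pnorm p (replicate m (0\<^sub>v 2) ! k) \<le> 1"
      using pnorm_zero_le_1 by simp
  qed simp
qed

end
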